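(* Let $G$ be a Garside group and $H$ an infinite cyclic subgroup of $G$. Then there exists an element $g\in G$ such that $g^{-1}Hg$ is $(1,2)$-quasi-isometric to the real line. In particular, $H$ is $(1,\epsilon)$-quasi-isometric to the real line for some $\epsilon\ge0$.
   Context: Garside groups. Let $M$ be a monoid. An atom is an element $a\in M\setminus\{1\}$ such that $a=bc$ implies $b=1$ or $c=1$. For $a\in M$, $|a|_{\max}$ is the supremum of the lengths of all expressions of $a$ in terms of atoms. $M$ is atomic if it is generated by its atoms and $|a|_{\max}<\infty$ for all $a\in M$. In an atomic monoid, $a\le_L b$ means $ac=b$ for some $c\in M$, and $a\le_R b$ means $ca=b$ for some $c\in M$; these are partial orders. A finitely generated monoid $M$ is a Garside monoid if it is atomic, left and right cancellative, the posets $(M,\le_L)$ and $(M,\le_R)$ are lattices, and there is an element $\Delta\in M$ (a Garside element) such that for every $a\in M$, $a\le_L\Delta$ iff $a\le_R\Delta$, and $\mathcal D=\{a\in M: a\le_L\Delta\}$ generates $M$. A Garside group $G$ is the group of fractions of a Garside monoid; $\Delta$ is fixed, and $G$ is generated by the finite set $\mathcal D$. Metrics. $|g|_{\mathcal D}$ is the shortest word length of $g\in G$ in the alphabet $\mathcal D\cup\mathcal D^{-1}$. A subgroup of $G$ carries the restriction of the word metric $d(x,y)=|x^{-1}y|_{\mathcal D}$ of $G$. The real line has its usual metric (equivalently up to isometry, the metric of a norm $\|x\|=c|x|$ with $c>0$). A map $f:X\to Y$ of metric spaces is a $(\lambda,\epsilon)$-quasi-isometric embedding ($\lambda\ge1$,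 $\epsilon\ge0$) if $\frac1\lambda d_X(x_1,x_2)-\epsilon\le d_Y(f(x_1),f(x_2))\le\lambda d_X(x_1,x_2)+\epsilon$ for all $x_1,x_2\in X$. It is a quasi-isometry if moreover for some $\delta\ge0$ every point of $Y$ lies in the $\delta$-neighborhood of $f(X)$. "$X$ is $(\lambda,\epsilon)$-quasi-isometric to $Y$" means there is a $(\lambda,\epsilon)$-quasi-isometric embedding $X\to Y$ which is a quasi-isometry. *)

theory Defs
  imports
    Complex_Main
    "HOL-Library.Extended_Nat"
    "HOL-Library.FuncSet"
    "HOL-Algebra.Lattice"
    "HOL-Algebra.Divisibility"
    "HOL-Algebra.Elementary_Groups"
begin

section \<open>Words in a monoid and atomic monoids\<close>

definition word_value :: "('a, 'b) monoid_scheme \<Rightarrow> 'a list \<Rightarrow> 'a" where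
  "word_value M ws = foldr (\<lambda>x y. x \<otimes>\<^bsub>M\<^esub> y) ws \<one>\<^bsub>M\<^esub>"

definition monoid_generates :: "('a, 'b) monoid_scheme \<Rightarrow> 'a set \<Rightarrow> bool" where
  "monoid_generates M S \<longleftrightarrow> S \<subseteq> carrier M \<and> carrier M = word_value M ` lists S"

definition atoms :: "('a, 'b) monoid_scheme \<Rightarrow> 'a set" where
  "atoms M = {a \<in> carrier M - {\<one>\<^bsub>M\<^esub>}.
     \<forall>b\<in>carrier M. \<forall>c\<in>carrier M. a = b \<otimes>\<^bsub>M\<^esub> c \<longrightarrow> b = \<one>\<^bsub>M\<^esub> \<or> c = \<one>\<^bsub>M\<^esub>}"

definition max_atom_length :: "('a, 'b) monoid_scheme \<Rightarrow> 'a \<Rightarrow> enat" where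
  "max_atom_length M a = (SUP ws \<in> {ws \<in> lists (atoms M). word_value M ws = a}. enat (length ws))"

definition atomic_monoid :: "('a, 'b) monoid_scheme \<Rightarrow> bool" where
  "atomic_monoid M \<longleftrightarrow> monoid M \<and> monoid_generates M (atoms M) \<and>
     (\<forall>a\<in>carrier M. max_atom_length M a < \<infinity>)"

section \<open>Garside monoids and their groups of fractions\<close>

definition left_le :: "('a, 'b) monoid_scheme \<Rightarrow> 'a \<Rightarrow> 'a \<Rightarrow> bool" where
  "left_le M a b \<longleftrightarrow> (\<exists>c\<in>carrier M. a \<otimes>\<^bsub>M\<^esub> c = b)"

definition right_le :: "('a, 'b) monoid_scheme \<Rightarrow> 'a \<Rightarrow> 'a \<Rightarrow> bool" where
  "right_le M a b \<longleftrightarrow> (\<exists>c\<in>carrier M. c \<otimes>\<^bsub>M\<^esub> a = b)"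

definition left_order :: "('a, 'b) monoid_scheme \<Rightarrow> 'a gorder" where
  "left_order M = \<lparr>carrier = carrier M, eq = (=), le = left_le M\<rparr>"

definition right_order :: "('a, 'b) monoid_scheme \<Rightarrow> 'a gorder" where
  "right_order M = \<lparr>carrier = carrier M, eq = (=), le = right_le M\<rparr>"

definition simple_elements :: "('a, 'b) monoid_scheme \<Rightarrow> 'a \<Rightarrow> 'a set" where
  "simple_elements M \<Delta> = {a \<in> carrier M. left_le M a \<Delta>}"

definition garside_element :: "('a, 'b) monoid_scheme \<Rightarrow> 'a \<Rightarrow> bool" where
  "garside_element M \<Delta> \<longleftrightarrow> \<Delta> \<in> carrier M \<and>
     (\<forall>a\<in>carrier M. left_le M a \<Delta> \<longleftrightarrow> right_le M a \<Delta>) \<and>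
     monoid_generates M (simple_elements M \<Delta>)"

definition garside_monoid :: "('a, 'b) monoid_scheme \<Rightarrow> bool" where
  "garside_monoid M \<longleftrightarrow>
     atomic_monoid M \<and> (\<exists>S. finite S \<and> monoid_generates M S) \<and> monoid_cancel M \<and>
     lattice (left_order M) \<and> lattice (right_order M) \<and> (\<exists>\<Delta>. garside_element M \<Delta>)"

text \<open>The group of fractions is taken up to isomorphism: a group together with an embedding of
  the monoid such that every group element is a right fraction.  A Garside monoid satisfies the
  Ore conditions on both sides, so left fractions would give the same notion.\<close>

definition group_of_fractions ::
  "('m, 'b) monoid_scheme \<Rightarrow> ('g, 'c) monoid_scheme \<Rightarrow> ('m \<Rightarrow> 'g) \<Rightarrow> bool" where
  "group_of_fractions M G \<iota> \<longleftrightarrow> group G \<and> \<iota> \<in> hom M G \<and> inj_on \<iota> (carrier M) \<and>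
     (\<forall>g\<in>carrier G. \<exists>a\<in>carrier M. \<exists>b\<in>carrier M. g = \<iota> a \<otimes>\<^bsub>G\<^esub> inv\<^bsub>G\<^esub> (\<iota> b))"

section \<open>Word metric\<close>

text \<open>Meaningful when \<open>A\<close> generates the group; otherwise \<open>LEAST\<close> may range over no number.\<close>

definition word_length :: "('g, 'c) monoid_scheme \<Rightarrow> 'g set \<Rightarrow> 'g \<Rightarrow> nat" where
  "word_length G A g =
     (LEAST n. \<exists>ws \<in> lists (A \<union> (\<lambda>a. inv\<^bsub>G\<^esub> a) ` A). length ws = n \<and> word_value G ws = g)"

definition word_dist :: "('g, 'c) monoid_scheme \<Rightarrow> 'g set \<Rightarrow> 'g \<Rightarrow> 'g \<Rightarrow> real" where
  "word_dist G A x y = real (word_length G A (inv\<^bsub>G\<^esub> x \<otimes>\<^bsub>G\<^esub> y))"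

definition garside_dist ::
  "('m, 'b) monoid_scheme \<Rightarrow> 'm \<Rightarrow> ('g, 'c) monoid_scheme \<Rightarrow> ('m \<Rightarrow> 'g) \<Rightarrow> 'g \<Rightarrow> 'g \<Rightarrow> real" where
  "garside_dist M \<Delta> G \<iota> = word_dist G (\<iota> ` simple_elements M \<Delta>)"

section \<open>Quasi-isometries\<close>

text \<open>As in \<open>Metric_space\<close>, a metric space is a carrier set with a distance function that is
  only relevant on that set, so a subspace keeps the distance function.\<close>

definition qi_embedding ::
  "real \<Rightarrow> real \<Rightarrow> 'x set \<Rightarrow> ('x \<Rightarrow> 'x \<Rightarrow> real) \<Rightarrow> 'y set \<Rightarrow> ('y \<Rightarrow> 'y \<Rightarrow> real) \<Rightarrow> ('x \<Rightarrow> 'y) \<Rightarrow> bool"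
  where
  "qi_embedding K \<epsilon> X dX Y dY f \<longleftrightarrow> K \<ge> 1 \<and> \<epsilon> \<ge> 0 \<and> f \<in> X \<rightarrow> Y \<and>
     (\<forall>x1\<in>X. \<forall>x2\<in>X. 1 / K * dX x1 x2 - \<epsilon> \<le> dY (f x1) (f x2) \<and>
                       dY (f x1) (f x2) \<le> K * dX x1 x2 + \<epsilon>)"

definition coarsely_surjective ::
  "'x set \<Rightarrow> 'y set \<Rightarrow> ('y \<Rightarrow> 'y \<Rightarrow> real) \<Rightarrow> ('x \<Rightarrow> 'y) \<Rightarrow> bool" where
  "coarsely_surjective X Y dY f \<longleftrightarrow> (\<exists>\<delta>\<ge>0. \<forall>y\<in>Y. \<exists>x\<in>X. dY y (f x) \<le> \<delta>)"

definition quasi_isometric ::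
  "real \<Rightarrow> real \<Rightarrow> 'x set \<Rightarrow> ('x \<Rightarrow> 'x \<Rightarrow> real) \<Rightarrow> 'y set \<Rightarrow> ('y \<Rightarrow> 'y \<Rightarrow> real) \<Rightarrow> bool" where
  "quasi_isometric K \<epsilon> X dX Y dY \<longleftrightarrow>
     (\<exists>f. qi_embedding K \<epsilon> X dX Y dY f \<and> coarsely_surjective X Y dY f)"

end

theory Submission
  imports Defs "HOL-Algebra.Multiplicative_Group"
begin

text \<open>
  The relation \<open>x \<le> y \<longleftrightarrow> x^(-1) y \<in> M\<close> makes \<open>G\<close> a lattice on which left translations and right
  multiplication by \<open>\<Delta>\<close> are automorphisms, and \<open>|g|\<close> is the least \<open>p + q\<close> with \<open>p, q \<ge> 0\<close> and
  \<open>\<Delta>^(-q) \<le> g \<le> \<Delta>^p\<close>.  Given such bounds for \<open>g^m\<close> with \<open>p + q = |g^m|\<close>, a finite join \<open>x\<close> of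
  elements \<open>g^r \<Delta>^(-j)\<close> satisfies \<open>\<Delta>^(-\<lceil>nq/m\<rceil>) \<le> x^(-1) g^n x \<le> \<Delta>^\<lceil>np/m\<rceil>\<close> for all \<open>n \<ge> 0\<close>, hence
  \<open>|x^(-1) g^n x| \<le> n |g^m| / m + 2\<close>.  The conjugates \<open>x^(-1) g x\<close> obtained for varying \<open>m\<close> have
  bounded length, so one of them works for infinitely many \<open>m\<close>; its powers have length within \<open>2\<close>
  of \<open>n T\<close>, where \<open>T\<close> is the translation length of \<open>g\<close>, and \<open>T > 0\<close> because balls are finite.
\<close>

section \<open>Word length in a group\<close>

lemma word_value_Nil [simp]: "word_value M [] = \<one>\<^bsub>M\<^esub>"
  by (simp add: word_value_def)

lemma word_value_Cons [simp]: "word_value M (w # ws) = w \<otimes>\<^bsub>M\<^esub> word_value M ws"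
  by (simp add: word_value_def)

lemma (in monoid) word_value_closed: "ws \<in> lists (carrier G) \<Longrightarrow> word_value G ws \<in> carrier G"
  by (induction ws) auto

lemma (in monoid) word_value_append:
  "us \<in> lists (carrier G) \<Longrightarrow> vs \<in> lists (carrier G) \<Longrightarrow>
    word_value G (us @ vs) = word_value G us \<otimes> word_value G vs"
  by (induction us) (auto simp: word_value_closed m_assoc)

lemma (in group) word_value_inv:
  "ws \<in> lists (carrier G) \<Longrightarrow>
    inv (word_value G ws) = word_value G (rev (map (\<lambda>x. inv x) ws))"
proof (induction ws)
  case (Cons w ws)
  then show ?case
    by (simp add: word_value_append word_value_closed inv_mult_group in_lists_conv_set)
qed simp

lemma (in group) inv_mult_cancel [simp]:
  assumes "x \<in> carrier G" "y \<in> carrier G"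
  shows "inv x \<otimes> (x \<otimes> y) = y" "x \<otimes> (inv x \<otimes> y) = y"
  using assms by (simp_all flip: m_assoc)

locale group_generators = group G for G :: "('g, 'c) monoid_scheme" (structure) +
  fixes A :: "'g set"
  assumes gen_closed: "A \<subseteq> carrier G"
    and gen_words: "g \<in> carrier G \<Longrightarrow> \<exists>ws\<in>lists (A \<union> (\<lambda>a. inv a) ` A). word_value G ws = g"
begin

abbreviation letters :: "'g set" where "letters \<equiv> A \<union> (\<lambda>a. inv a) ` A"

text \<open>The type constraints stop the exponents from being coerced to \<open>real\<close> in estimates.\<close>

abbreviation npow :: "'g \<Rightarrow> nat \<Rightarrow> 'g" (infixr "\<up>" 75) where "x \<up> n \<equiv> x [^] n"

abbreviation zpow :: "'g \<Rightarrow> int \<Rightarrow> 'g" (infixr "\<Up>" 75) where "x \<Up> n \<equiv> x [^] n"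

abbreviation len :: "'g \<Rightarrow> nat" where "len \<equiv> word_length G A"

lemma letters_closed: "letters \<subseteq> carrier G"
  using gen_closed by auto

lemma lists_letters: "ws \<in> lists letters \<Longrightarrow> ws \<in> lists (carrier G)"
  using letters_closed by auto

lemma len_le: "ws \<in> lists letters \<Longrightarrow> len (word_value G ws) \<le> length ws"
  unfolding word_length_def by (rule Least_le) blast

lemma len_word:
  assumes "g \<in> carrier G"
  obtains ws where "ws \<in> lists letters" "length ws = len g" "word_value G ws = g"
proof -
  let ?Q = "\<lambda>n. \<exists>ws \<in> lists letters. length ws = n \<and> word_value G ws = g"
  have "\<exists>n. ?Q n" using gen_words[OF assms] by blast
  then have "?Q (len g)" unfolding word_length_def by (rule LeastI_ex)
  then show thesis using that by blast
qed

lemma len_one [simp]: "len \<one> = 0"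
  using len_le[of "[]"] by simp

lemma len_mult:
  assumes "x \<in> carrier G" "y \<in> carrier G"
  shows "len (x \<otimes> y) \<le> len x + len y"
proof -
  obtain us where us: "us \<in> lists letters" "length us = len x" "word_value G us = x"
    using len_word assms by metis
  obtain vs where vs: "vs \<in> lists letters" "length vs = len y" "word_value G vs = y"
    using len_word assms by metis
  have "us @ vs \<in> lists letters" using us vs by auto
  from len_le[OF this] show ?thesis using us vs lists_letters by (simp add: word_value_append)
qed

lemma len_letter: "a \<in> letters \<Longrightarrow> len a \<le> 1"
  using len_le[of "[a]"] letters_closed by (auto simp: subset_iff)

lemma letters_inv: "a \<in> letters \<Longrightarrow> inv a \<in> letters"
  using gen_closed by auto

lemma len_inv_le:
  assumes "x \<in> carrier G"
  shows "len (inv x) \<le> len x"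
proof -
  obtain ws where ws: "ws \<in> lists letters" "length ws = len x" "word_value G ws = x"
    using len_word assms by metis
  then have "rev (map (\<lambda>x. inv x) ws) \<in> lists letters"
    using letters_inv by (auto simp: in_lists_conv_set)
  from len_le[OF this] show ?thesis
    using ws word_value_inv[OF lists_letters[OF ws(1)]] by simp
qed

lemma len_inv: "x \<in> carrier G \<Longrightarrow> len (inv x) = len x"
  using len_inv_le[of x] len_inv_le[of "inv x"] by simp

lemma len_conj:
  assumes "x \<in> carrier G" "y \<in> carrier G"
  shows "len (inv x \<otimes> y \<otimes> x) \<le> len y + 2 * len x"
  using len_mult[of "inv x \<otimes> y" x] len_mult[of "inv x" y] len_inv[of x] assms by simp

lemma len_conj':
  assumes "x \<in> carrier G" "y \<in> carrier G"
  shows "len y \<le> len (inv x \<otimes> y \<otimes> x) + 2 * len x"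
proof -
  have "y = inv (inv x) \<otimes> (inv x \<otimes> y \<otimes> x) \<otimes> inv x"
    using assms by (simp add: m_assoc)
  then show ?thesis
    using len_conj[of "inv x" "inv x \<otimes> y \<otimes> x"] len_inv[of x] assms by simp
qed

lemma len_pow: "x \<in> carrier G \<Longrightarrow> len (x [^] (n::nat)) \<le> n * len x"
proof (induction n)
  case (Suc n)
  then show ?case using len_mult[of "x [^] n" x] by simp
qed simp

lemma len_int_pow: "x \<in> carrier G \<Longrightarrow> len (x [^] (n::int)) = len (x \<up> nat \<bar>n\<bar>)"
  by (cases n rule: int_cases2) (simp_all add: int_pow_int int_pow_neg len_inv)

text \<open>Words of bounded length over a finite alphabet are finite in number. This drives both
  the pigeonhole choice of a conjugator and the positivity of the translation length.\<close>

lemma finite_len_ball: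
  assumes "finite A"
  shows "finite {x \<in> carrier G. len x \<le> n}"
proof (rule finite_subset)
  show "finite (word_value G ` {ws. set ws \<subseteq> letters \<and> length ws \<le> n})"
    using assms by (intro finite_imageI finite_lists_length_le) simp
  show "{x \<in> carrier G. len x \<le> n} \<subseteq> word_value G ` {ws. set ws \<subseteq> letters \<and> length ws \<le> n}"
  proof
    fix x assume "x \<in> {x \<in> carrier G. len x \<le> n}"
    moreover from this obtain ws
      where "ws \<in> lists letters" "length ws = len x" "word_value G ws = x"
      using len_word by blast
    ultimately show "x \<in> word_value G ` {ws. set ws \<subseteq> letters \<and> length ws \<le> n}"
      by (auto simp: image_iff lists_eq_set)
  qed
qed

lemma conj_nat_pow:
  assumes "x \<in> carrier G" "g \<in> carrier G"
  shows "inv x \<otimes> g [^] (n::nat) \<otimes> x = (inv x \<otimes> g \<otimes> x) [^] n"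
proof (induction n)
  case (Suc n)
  have "(inv x \<otimes> g [^] n \<otimes> x) \<otimes> (inv x \<otimes> g \<otimes> x) = inv x \<otimes> g [^] n \<otimes> (x \<otimes> inv x) \<otimes> g \<otimes> x"
    using assms by (simp only: m_assoc m_closed inv_closed nat_pow_closed)
  also have "\<dots> = inv x \<otimes> g [^] Suc n \<otimes> x"
    using assms by (simp add: m_assoc)
  finally show ?case by (simp only: Suc nat_pow_Suc)
qed (use assms in simp)

lemma conj_int_pow:
  assumes "x \<in> carrier G" "g \<in> carrier G"
  shows "inv x \<otimes> g [^] (n::int) \<otimes> x = (inv x \<otimes> g \<otimes> x) [^] n"
proof -
  have inv: "inv x \<otimes> inv (g \<up> k) \<otimes> x = inv (inv x \<otimes> g \<up> k \<otimes> x)" for k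
    using assms by (simp add: inv_mult_group m_assoc)
  show ?thesis
    by (cases n rule: int_cases2)
      (use assms in \<open>simp_all add: int_pow_int int_pow_neg inv conj_nat_pow\<close>)
qed

section \<open>Translation length and a common conjugator\<close>

text \<open>The lengths of all conjugates involved are bounded, so by finiteness of balls a single
  conjugate serves infinitely many exponents \<open>m = l!\<close>; along factorials \<open>len (g^m) / m\<close> decreases
  to the translation length.\<close>

lemma conjugate_near_linear:
  fixes C :: nat
  assumes "finite A" and g: "g \<in> carrier G"
    and near: "\<And>m::nat. m > 0 \<Longrightarrow> \<exists>x\<in>carrier G. \<forall>n::nat.
      real (len (inv x \<otimes> g \<up> n \<otimes> x)) \<le> n * real (len (g \<up> m)) / m + C"
  obtains x and T :: real where "x \<in> carrier G" "T \<ge> 0"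
    "\<And>n::nat. n * T \<le> len (inv x \<otimes> g \<up> n \<otimes> x)"
    "\<And>n::nat. len (inv x \<otimes> g \<up> n \<otimes> x) \<le> n * T + C"
proof -
  define f :: "nat \<Rightarrow> real" where "f l = real (len (g \<up> (fact l :: nat))) / fact l" for l
  have f0: "f l \<ge> 0" for l by (simp add: f_def)
  have "f (Suc l) \<le> f l" for l
  proof -
    have "g \<up> (fact (Suc l) :: nat) = (g \<up> (fact l :: nat)) \<up> Suc l"
      using g by (simp only: nat_pow_pow fact_Suc of_nat_id mult.commute)
    then have "len (g \<up> (fact (Suc l) :: nat)) \<le> Suc l * len (g \<up> (fact l :: nat))"
      using len_pow[of "g \<up> (fact l :: nat)" "Suc l"] g by (simp del: fact_Suc nat_pow_Suc mult_Suc)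
    then have "real (len (g \<up> (fact (Suc l) :: nat))) \<le> real (Suc l) * len (g \<up> (fact l :: nat))"
      by (metis of_nat_le_iff of_nat_mult)
    then have "f (Suc l) \<le> real (Suc l) * len (g \<up> (fact l :: nat)) / fact (Suc l)"
      unfolding f_def by (intro divide_right_mono) auto
    also have "\<dots> = f l" by (simp add: f_def del: of_nat_Suc)
    finally show ?thesis .
  qed
  then have dec: "decseq f" by (simp add: decseq_Suc_iff)
  obtain T where T: "f \<longlonglongrightarrow> T" "\<And>l. T \<le> f l"
    using decseq_convergent[OF dec, of 0] f0 by blast
  have "\<exists>x\<in>carrier G. \<forall>n::nat. real (len (inv x \<otimes> g \<up> n \<otimes> x)) \<le> n * f l + C" for l
    using near[of "fact l"] by (simp add: f_def)
  then obtain X where X: "\<And>l. X l \<in> carrier G"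
    "\<And>l n::nat. real (len (inv (X l) \<otimes> g \<up> n \<otimes> X l)) \<le> n * f l + C"
    by metis
  define h where "h l = inv (X l) \<otimes> g \<otimes> X l" for l
  have "f l \<le> len g" for l
    using decseqD[OF dec, of 0 l] g by (simp add: f_def)
  \<comment> \<open>Taking \<open>n = 1\<close> in the bound for \<open>X l\<close> confines every
    \<open>h l\<close> to one ball, since \<open>f l \<le> f 0 = len g\<close>.\<close>
  then have "real (len (h l)) \<le> len g + C" for l
    using X(2)[of l 1] g order_trans add_right_mono unfolding h_def by fastforce
  then have "len (h l) \<le> len g + C" for l
    by (simp only: of_nat_le_iff)
  then have "range h \<subseteq> {x \<in> carrier G. len x \<le> len g + C}"
    using X(1) g by (auto simp: h_def)
  then have "finite (range h)"
    using finite_len_ball[OF \<open>finite A\<close>] finite_subset by blast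
  then obtain k where inf: "infinite {l. h l = h k}"
    using inf_img_fin_dom[of h UNIV] by (auto simp: vimage_def)
  define x where "x = X k"
  have x: "x \<in> carrier G" using X by (simp add: x_def)
  \<comment> \<open>The conjugate \<open>h l\<close> determines all conjugated powers, so a bound
    proved for \<open>X l\<close> holds for \<open>x\<close> whenever \<open>h l = h k\<close>, even
    if \<open>X l\<close> differs from \<open>x\<close>.\<close>
  have pow: "inv (X l) \<otimes> g \<up> n \<otimes> X l = inv x \<otimes> g \<up> n \<otimes> x" if "h l = h k" for l and n :: nat
    using that X(1) g by (simp add: conj_nat_pow x_def h_def)
  have upper: "len (inv x \<otimes> g \<up> n \<otimes> x) \<le> n * T + C" for n :: nat
  proof (rule LIMSEQ_le_const)
    show "(\<lambda>l. n * f l + C) \<longlonglongrightarrow> n * T + C"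
      using T by (intro tendsto_intros)
    \<comment> \<open>Indices \<open>l'\<close> with \<open>h l' = h k\<close> exist beyond every
      \<open>l\<close>, and \<open>f\<close> decreases, so the bound holds for every
      \<open>l\<close> and survives the limit.\<close>
    have "real (len (inv x \<otimes> g \<up> n \<otimes> x)) \<le> n * f l + C" for l
    proof -
      obtain l' where l': "l' \<ge> l" "h l' = h k"
        using inf by (metis (mono_tags, lifting) infinite_nat_iff_unbounded_le mem_Collect_eq)
      have "real (len (inv x \<otimes> g \<up> n \<otimes> x)) \<le> n * f l' + C"
        using X(2)[of l' n] pow[OF l'(2)] by simp
      also have "\<dots> \<le> n * f l + C"
        using decseqD[OF dec l'(1)] by (simp add: mult_left_mono)
      finally show ?thesis .
    qed
    then show "\<exists>N. \<forall>l\<ge>N. real (len (inv x \<otimes> g \<up> n \<otimes> x)) \<le> n * f l + C" by blast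
  qed
  have lower: "n * T \<le> len (inv x \<otimes> g \<up> n \<otimes> x)" for n :: nat
  proof (cases "n = 0")
    case False
    let ?L = "len (inv x \<otimes> g \<up> n \<otimes> x)"
    have "T \<le> ?L / n"
    proof (rule LIMSEQ_le[OF T(1)])
      have "real l \<le> fact l" for l by (metis fact_ge_self of_nat_fact of_nat_le_iff)
      then have "filterlim (\<lambda>l. fact l :: real) at_top sequentially"
        by (intro filterlim_at_top_mono[OF filterlim_real_sequentially] always_eventually allI)
      then have "(\<lambda>l. ?L / n + 2 * len x / fact l) \<longlonglongrightarrow> ?L / n + 0"
        by (intro tendsto_intros real_tendsto_divide_at_top[OF tendsto_const])
      then show "(\<lambda>l. ?L / n + 2 * len x / fact l) \<longlonglongrightarrow> ?L / n" by simp
      \<comment> \<open>For \<open>l \<ge> n\<close> the exponent \<open>fact l\<close> is a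
        multiple \<open>n * s\<close>; passing from \<open>g\<close> to its conjugate costs
        \<open>2 * len x\<close>, which is negligible against \<open>fact l\<close>.\<close>
      have "f l \<le> ?L / n + 2 * len x / fact l" if "l \<ge> n" for l
      proof -
        have "n dvd fact l" using that False by (intro dvd_fact) auto
        then obtain s where s: "(fact l :: nat) = n * s" by blast
        then have s': "(fact l :: real) = n * s" by (metis of_nat_fact of_nat_mult)
        then have "s > 0" by (metis fact_nonzero mult_eq_0_iff neq0_conv of_nat_0)
        have "len (g \<up> (fact l :: nat)) \<le> len (inv x \<otimes> g \<up> (fact l :: nat) \<otimes> x) + 2 * len x"
          using len_conj' x g by simp
        also have "inv x \<otimes> g \<up> (fact l :: nat) \<otimes> x = (inv x \<otimes> g \<up> n \<otimes> x) \<up> s"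
          using x g by (simp add: conj_nat_pow nat_pow_pow s)
        also have "len \<dots> \<le> s * ?L" using len_pow x g by simp
        finally have "real (len (g \<up> (fact l :: nat))) \<le> s * ?L + 2 * len x"
          by (metis (mono_tags, lifting) add_le_cancel_right of_nat_add of_nat_le_iff of_nat_mult of_nat_numeral)
        then have "f l \<le> (s * ?L + 2 * len x) / fact l"
          unfolding f_def by (intro divide_right_mono) auto
        also have "\<dots> = ?L / n + 2 * len x / fact l"
          using False \<open>s > 0\<close> by (simp add: s' field_simps)
        finally show ?thesis .
      qed
      then show "\<exists>N. \<forall>l\<ge>N. f l \<le> ?L / n + 2 * len x / fact l" by blast
    qed
    then show ?thesis using False by (simp add: field_simps)
  qed simp
  have "T \<ge> 0" using LIMSEQ_le_const[OF T(1)] f0 by blast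
  from that[OF x this lower upper] show thesis .
qed

end


section \<open>The lattice order on a Garside group\<close>

text \<open>\<open>P\<close> is the positive cone, the image of the monoid, and \<open>A\<close> the
  set of simple elements. \<open>P_conj\<close> and \<open>P_conj'\<close> make right multiplication
  by \<Delta> and by its inverse monotone. \<open>P_join\<close> speaks of positive elements and
  positive upper bounds; \<open>join_pair\<close> extends it to the whole group.\<close>

locale garside_group = group_generators G A
  for G :: "('g, 'c) monoid_scheme" (structure) and A +
  fixes P :: "'g set" and \<Delta> :: 'g
  assumes P_closed: "x \<in> P \<Longrightarrow> x \<in> carrier G"
    and P_one: "\<one> \<in> P"
    and P_mult: "x \<in> P \<Longrightarrow> y \<in> P \<Longrightarrow> x \<otimes> y \<in> P"
    and P_antisym: "x \<in> P \<Longrightarrow> inv x \<in> P \<Longrightarrow> x = \<one>"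
    and Delta_P: "\<Delta> \<in> P"
    and P_conj: "x \<in> P \<Longrightarrow> inv \<Delta> \<otimes> x \<otimes> \<Delta> \<in> P"
    and P_conj': "x \<in> P \<Longrightarrow> \<Delta> \<otimes> x \<otimes> inv \<Delta> \<in> P"
    and A_eq: "A = {a \<in> P. inv a \<otimes> \<Delta> \<in> P}"
    and P_join: "x \<in> P \<Longrightarrow> y \<in> P \<Longrightarrow> \<exists>z\<in>P. inv x \<otimes> z \<in> P \<and> inv y \<otimes> z \<in> P \<and>
      (\<forall>w\<in>P. inv x \<otimes> w \<in> P \<longrightarrow> inv y \<otimes> w \<in> P \<longrightarrow> inv z \<otimes> w \<in> P)"
begin

abbreviation le :: "'g \<Rightarrow> 'g \<Rightarrow> bool" (infix "\<preceq>" 50) where "x \<preceq> y \<equiv> inv x \<otimes> y \<in> P"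

abbreviation Dpow :: "int \<Rightarrow> 'g" where "Dpow j \<equiv> \<Delta> [^] j"

lemma Delta_closed [simp]: "\<Delta> \<in> carrier G"
  using Delta_P P_closed by blast

lemma Dpow_add: "Dpow (i + j) = Dpow i \<otimes> Dpow j"
  by (simp add: int_pow_mult)

lemma le_refl: "x \<in> carrier G \<Longrightarrow> x \<preceq> x"
  using P_one by simp

lemma le_trans:
  assumes "x \<in> carrier G" "y \<in> carrier G" "z \<in> carrier G" "x \<preceq> y" "y \<preceq> z"
  shows "x \<preceq> z"
proof -
  have "(inv x \<otimes> y) \<otimes> (inv y \<otimes> z) \<in> P" using assms P_mult by blast
  then show ?thesis using assms by (simp add: m_assoc)
qed

lemma le_antisym:
  assumes "x \<in> carrier G" "y \<in> carrier G" "x \<preceq> y" "y \<preceq> x"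
  shows "x = y"
proof -
  have "inv x \<otimes> y = \<one>"
    using P_antisym[of "inv x \<otimes> y"] assms by (simp add: inv_mult_group)
  then show ?thesis using assms by (metis inv_mult_cancel(2) r_one)
qed

lemma le_mult_left:
  assumes "x \<in> carrier G" "y \<in> carrier G" "z \<in> carrier G"
  shows "z \<otimes> x \<preceq> z \<otimes> y \<longleftrightarrow> x \<preceq> y"
  using assms by (simp add: inv_mult_group m_assoc)

lemma P_conj_nat:
  assumes "x \<in> P"
  shows "inv (\<Delta> \<up> n) \<otimes> x \<otimes> \<Delta> \<up> n \<in> P" "\<Delta> \<up> n \<otimes> x \<otimes> inv (\<Delta> \<up> n) \<in> P"
proof -
  have x: "x \<in> carrier G" using assms P_closed by blast
  show "inv (\<Delta> \<up> n) \<otimes> x \<otimes> \<Delta> \<up> n \<in> P"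
  proof (induction n)
    case (Suc n)
    from P_conj[OF this] show ?case using x by (simp add: m_assoc inv_mult_group)
  qed (use assms x in simp)
  have pow: "\<Delta> \<otimes> \<Delta> \<up> n = \<Delta> \<up> n \<otimes> \<Delta>" for n
    using nat_pow_Suc2[of \<Delta> n] by simp
  show "\<Delta> \<up> n \<otimes> x \<otimes> inv (\<Delta> \<up> n) \<in> P"
  proof (induction n)
    case (Suc n)
    from P_conj'[OF this] have "(\<Delta> \<otimes> \<Delta> \<up> n) \<otimes> x \<otimes> inv (\<Delta> \<otimes> \<Delta> \<up> n) \<in> P"
      using x by (simp add: m_assoc inv_mult_group)
    then show ?case unfolding pow by simp
  qed (use assms x in simp)
qed

lemma P_conj_int: "x \<in> P \<Longrightarrow> inv (Dpow j) \<otimes> x \<otimes> Dpow j \<in> P"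
  using P_conj_nat by (cases j rule: int_cases2) (auto simp: int_pow_int int_pow_neg)

text \<open>The quotient of the two sides is the conjugate of \<open>inv x \<otimes> y\<close> by a
  power of \<Delta>, and such conjugation preserves \<open>P\<close>.\<close>

lemma le_mult_right:
  assumes "x \<in> carrier G" "y \<in> carrier G" "x \<preceq> y"
  shows "x \<otimes> Dpow j \<preceq> y \<otimes> Dpow j"
  using P_conj_int[OF assms(3), of j] assms by (simp add: inv_mult_group m_assoc)

lemma le_mult_right_neg:
  assumes "x \<in> carrier G" "y \<in> carrier G" "x \<otimes> Dpow (- j) \<preceq> y"
  shows "x \<preceq> y \<otimes> Dpow j"
  using le_mult_right[of "x \<otimes> Dpow (- j)" y j] assms
  by (simp add: m_assoc int_pow_neg)

lemma Dpow_mono: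
  assumes "i \<le> j"
  shows "Dpow i \<preceq> Dpow j"
proof -
  have "\<Delta> \<up> n \<in> P" for n
    by (induction n) (auto simp: P_one P_mult Delta_P)
  then have "Dpow (j - i) \<in> P"
    using assms by (metis diff_ge_0_iff_ge int_pow_int zero_le_imp_eq_int)
  moreover have "Dpow j = Dpow i \<otimes> Dpow (j - i)"
    by (metis Dpow_add add.commute diff_add_cancel)
  ultimately show ?thesis by simp
qed

lemma le_Dpow_mult:
  assumes "x \<in> carrier G" "y \<in> carrier G" "x \<preceq> Dpow i" "y \<preceq> Dpow j"
  shows "x \<otimes> y \<preceq> Dpow (i + j)"
proof (rule le_trans)
  show "x \<otimes> y \<preceq> x \<otimes> Dpow j" using assms by (subst le_mult_left) auto
  show "x \<otimes> Dpow j \<preceq> Dpow (i + j)" using assms le_mult_right by (simp add: Dpow_add)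
qed (use assms in auto)

text \<open>Inversion need not reverse a left-invariant order. Here one side asks for
  \<open>x \<otimes> Dpow j\<close> in \<open>P\<close> and the other for
  \<open>Dpow j \<otimes> x\<close>; these are conjugate by a power of \<Delta>, hence positive
  together.\<close>

lemma inv_le_Dpow_iff:
  assumes "x \<in> carrier G"
  shows "inv x \<preceq> Dpow j \<longleftrightarrow> Dpow (- j) \<preceq> x"
proof -
  have "inv x \<preceq> Dpow j \<longleftrightarrow> x \<otimes> Dpow j \<in> P" using assms by simp
  also have "\<dots> \<longleftrightarrow> Dpow j \<otimes> x \<in> P"
  proof
    assume "x \<otimes> Dpow j \<in> P"
    from P_conj_int[OF this, of "- j"] show "Dpow j \<otimes> x \<in> P"
      using assms by (simp add: m_assoc int_pow_neg)
  next
    assume "Dpow j \<otimes> x \<in> P"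
    from P_conj_int[OF this, of j] show "x \<otimes> Dpow j \<in> P"
      using assms by (simp add: m_assoc)
  qed
  also have "\<dots> \<longleftrightarrow> Dpow (- j) \<preceq> x" using assms by (simp add: int_pow_neg)
  finally show ?thesis .
qed

lemma Dpow_le_inv_iff:
  assumes "x \<in> carrier G"
  shows "Dpow j \<preceq> inv x \<longleftrightarrow> x \<preceq> Dpow (- j)"
  using inv_le_Dpow_iff[of "inv x" "- j"] assms by simp

lemma Dpow_le_mult:
  assumes "x \<in> carrier G" "y \<in> carrier G" "Dpow i \<preceq> x" "Dpow j \<preceq> y"
  shows "Dpow (i + j) \<preceq> x \<otimes> y"
proof -
  have "inv y \<preceq> Dpow (- j)" "inv x \<preceq> Dpow (- i)"
    using assms by (simp_all only: inv_le_Dpow_iff minus_minus)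
  then have "inv y \<otimes> inv x \<preceq> Dpow (- j + - i)"
    using assms le_Dpow_mult by blast
  then show ?thesis
    using inv_le_Dpow_iff[of "x \<otimes> y" "- j + - i"] assms by (simp add: inv_mult_group add.commute)
qed

text \<open>Letters in \<open>A\<close> lie between \<open>\<one>\<close> and \<Delta>, their
  inverses between \<open>Dpow (- 1)\<close> and \<open>\<one>\<close>, and exponents of such bounds
  add under products. In a shortest word, \<open>p\<close> counts the letters in \<open>A\<close>
  and \<open>q\<close> the others.\<close>

lemma len_bounds:
  assumes "g \<in> carrier G"
  obtains p q where "p + q = len g" "Dpow (- int q) \<preceq> g" "g \<preceq> Dpow (int p)"
proof -
  have "\<exists>p q. p + q = length ws \<and> Dpow (- int q) \<preceq> word_value G ws \<and> word_value G ws \<preceq> Dpow (int p)"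
    if "ws \<in> lists letters" for ws
    using that
  proof (induction ws)
    case Nil
    then show ?case using P_one by simp
  next
    case (Cons w ws)
    then have w: "w \<in> letters" "w \<in> carrier G" and ws: "word_value G ws \<in> carrier G"
      using letters_closed word_value_closed[OF lists_letters] by auto
    obtain p q where pq: "p + q = length ws" "Dpow (- int q) \<preceq> word_value G ws"
      "word_value G ws \<preceq> Dpow (int p)" using Cons by auto
    show ?case
    proof (cases "w \<in> A")
      case True
      then have "Dpow 0 \<preceq> w" "w \<preceq> Dpow 1"
        using A_eq w by auto
      then have "Dpow (0 + - int q) \<preceq> w \<otimes> word_value G ws"
        "w \<otimes> word_value G ws \<preceq> Dpow (1 + int p)"
        using pq w ws by (blast intro: le_Dpow_mult Dpow_le_mult)+
      then show ?thesis using pq by (intro exI[of _ "Suc p"] exI[of _ q]) simp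
    next
      case False
      then obtain a where a: "a \<in> A" "w = inv a" "a \<in> carrier G"
        using w gen_closed by auto
      then have "Dpow 0 \<preceq> a" "a \<preceq> Dpow 1"
        using A_eq by auto
      then have "Dpow (- 1) \<preceq> w" "w \<preceq> Dpow 0"
        unfolding a(2)
        using Dpow_le_inv_iff[OF a(3), of "- 1"] inv_le_Dpow_iff[OF a(3), of 0] by simp_all
      then have "Dpow (- 1 + - int q) \<preceq> w \<otimes> word_value G ws"
        "w \<otimes> word_value G ws \<preceq> Dpow (0 + int p)"
        using pq w ws by (blast intro: le_Dpow_mult Dpow_le_mult)+
      then show ?thesis using pq by (intro exI[of _ p] exI[of _ "Suc q"]) simp
    qed
  qed
  then show thesis using len_word[OF assms] that by metis
qed

section \<open>Joins of finite sets in the group\<close>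

definition is_join :: "'g set \<Rightarrow> 'g \<Rightarrow> bool" where
  "is_join S z \<longleftrightarrow> z \<in> carrier G \<and> (\<forall>s\<in>S. s \<preceq> z) \<and> (\<forall>w\<in>carrier G. (\<forall>s\<in>S. s \<preceq> w) \<longrightarrow> z \<preceq> w)"

text \<open>Left multiplication by a high power of \<Delta> moves both elements into
  \<open>P\<close>, where joins exist; left translation is an order automorphism, so the join can be
  moved back.\<close>

lemma join_pair:
  assumes x: "x \<in> carrier G" and y: "y \<in> carrier G"
  shows "\<exists>z. is_join {x, y} z"
proof -
  have "\<exists>n::nat. Dpow (- int n) \<preceq> x" if "x \<in> carrier G" for x
    by (rule len_bounds[OF that]) (rule exI)
  then obtain m n where mn: "Dpow (- int m) \<preceq> x" "Dpow (- int n) \<preceq> y"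
    using x y by meson
  define d where "d = Dpow (- int (m + n))"
  have d: "d \<in> carrier G" by (simp add: d_def)
  have dx: "d \<preceq> x"
    using le_trans[OF _ _ x Dpow_mono mn(1), of "- int (m + n)"] by (simp add: d_def)
  have dy: "d \<preceq> y"
    using le_trans[OF _ _ y Dpow_mono mn(2), of "- int (m + n)"] by (simp add: d_def)
  obtain z where z: "z \<in> P" "inv d \<otimes> x \<preceq> z" "inv d \<otimes> y \<preceq> z"
    "\<And>w. w \<in> P \<Longrightarrow> inv d \<otimes> x \<preceq> w \<Longrightarrow> inv d \<otimes> y \<preceq> w \<Longrightarrow> z \<preceq> w"
    using P_join[OF dx dy] by blast
  have zc: "z \<in> carrier G" using z P_closed by blast
  have shift: "inv d \<otimes> a \<preceq> b \<longleftrightarrow> a \<preceq> d \<otimes> b" if "a \<in> carrier G" "b \<in> carrier G" for a b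
    using le_mult_left[of "inv d \<otimes> a" b d] that d by simp
  \<comment> \<open>Every common upper bound \<open>w\<close> also lies above \<open>d\<close>, so
    \<open>inv d \<otimes> w\<close> is positive and the minimality of \<open>z\<close> within
    \<open>P\<close> applies to it.\<close>
  have "d \<otimes> z \<preceq> w" if w: "w \<in> carrier G" "x \<preceq> w" "y \<preceq> w" for w
  proof -
    have "inv d \<otimes> w \<in> P" using le_trans[OF d x w(1) dx w(2)] .
    then have "z \<preceq> inv d \<otimes> w" using z(4) shift x y w d by simp
    then show ?thesis using w d zc by (simp add: inv_mult_group m_assoc)
  qed
  then have "is_join {x, y} (d \<otimes> z)"
    unfolding is_join_def using z shift x y d zc by simp
  then show ?thesis ..
qed

lemma join_finite:
  assumes "finite S" "S \<noteq> {}" "S \<subseteq> carrier G"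
  shows "\<exists>z. is_join S z"
  using assms
proof (induction S rule: finite_ne_induct)
  case (singleton x)
  then show ?case using le_refl by (auto simp: is_join_def)
next
  case (insert x S)
  then obtain y where y: "is_join S y" by auto
  then have "x \<in> carrier G" "y \<in> carrier G" using insert by (auto simp: is_join_def)
  then obtain z where z: "is_join {x, y} z" using join_pair by blast
  have "s \<preceq> z" if "s \<in> S" for s
    using le_trans[of s y z] that y z insert.prems by (auto simp: is_join_def)
  then have "is_join (insert x S) z"
    using y z by (auto simp: is_join_def)
  then show ?case ..
qed

section \<open>Word length and the bounds by powers of the Garside element\<close>

text \<open>The join \<open>z\<close> of \<open>g\<close> and \<open>Dpow (- int q)\<close> has the
  better lower bound and keeps the upper one. Both elements lie below
  \<open>g \<otimes> \<Delta>\<close>, hence so does \<open>z\<close>; thus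
  \<open>inv g \<otimes> z\<close> is simple and the change costs one letter.\<close>

lemma peel_letter:
  assumes g: "g \<in> carrier G" and lower: "Dpow (- int (Suc q)) \<preceq> g" and upper: "g \<preceq> Dpow (int p)"
  obtains z where "z \<in> carrier G" "Dpow (- int q) \<preceq> z" "z \<preceq> Dpow (int p)" "len g \<le> Suc (len z)"
proof -
  obtain z where z: "is_join {g, Dpow (- int q)} z"
    using join_pair[OF g] by (metis Delta_closed int_pow_closed)
  then have zc: "z \<in> carrier G" and gz: "g \<preceq> z" and qz: "Dpow (- int q) \<preceq> z"
    by (auto simp: is_join_def)
  have least: "z \<preceq> w" if "w \<in> carrier G" "g \<preceq> w" "Dpow (- int q) \<preceq> w" for w
    using z that by (auto simp: is_join_def)
  have zp: "z \<preceq> Dpow (int p)"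
    using least upper Dpow_mono by simp
  have "Dpow (- int (Suc q) + 1) \<preceq> g \<otimes> Dpow 1"
    using le_mult_right[OF _ g lower] by (simp only: Dpow_add Delta_closed int_pow_closed)
  then have "z \<preceq> g \<otimes> \<Delta>"
    using g Delta_P by (intro least) auto
  then have "inv g \<otimes> z \<in> A"
    using A_eq gz g zc by (simp add: inv_mult_group m_assoc)
  then have u: "inv (inv g \<otimes> z) \<in> letters" by blast
  have "len g = len (z \<otimes> inv (inv g \<otimes> z))"
    using g zc by (simp add: inv_mult_group)
  also have "\<dots> \<le> len z + len (inv (inv g \<otimes> z))"
    using g zc by (intro len_mult) auto
  also have "\<dots> \<le> Suc (len z)" using len_letter[OF u] by simp
  finally show thesis using that zc qz zp by blast
qed

text \<open>Peel \<open>q\<close> letters until the lower bound is \<open>\<one>\<close>, invert,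
  which exchanges the bounds, and peel \<open>p\<close> more until only \<open>\<one>\<close> is
  left. With \<open>len_bounds\<close>, this makes \<open>len g\<close> the least such
  \<open>p + q\<close>.\<close>

lemma len_le_of_bounds:
  assumes "g \<in> carrier G" "Dpow (- int q) \<preceq> g" "g \<preceq> Dpow (int p)"
  shows "len g \<le> p + q"
proof -
  have reduce: "len g \<le> p + q"
    if base: "\<And>g. g \<in> carrier G \<Longrightarrow> Dpow 0 \<preceq> g \<Longrightarrow> g \<preceq> Dpow (int p) \<Longrightarrow> len g \<le> p"
      and "g \<in> carrier G" "Dpow (- int q) \<preceq> g" "g \<preceq> Dpow (int p)" for g p q
    using that(2-)
  proof (induction q arbitrary: g)
    case 0
    then show ?case using base by simp
  next
    case (Suc q)
    obtain z where "z \<in> carrier G" "Dpow (- int q) \<preceq> z" "z \<preceq> Dpow (int p)" "len g \<le> Suc (len z)"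
      using peel_letter Suc.prems by blast
    then show ?case using Suc.IH[of z] by simp
  qed
  have "len g \<le> 0" if "g \<in> carrier G" "Dpow 0 \<preceq> g" "g \<preceq> Dpow (int 0)" for g
    using le_antisym[of g \<one>] that by simp
  from reduce[OF this] have neg: "len g \<le> q" if "g \<in> carrier G" "Dpow (- int q) \<preceq> g" "g \<preceq> Dpow 0" for g q
    using that by simp
  have "len g \<le> p" if "g \<in> carrier G" "Dpow 0 \<preceq> g" "g \<preceq> Dpow (int p)" for g
    using neg[of "inv g" p] that inv_le_Dpow_iff[of g 0] Dpow_le_inv_iff[of g "- int p"]
    by (simp add: len_inv)
  from reduce[OF this assms] show ?thesis .
qed

text \<open>Positive powers accumulate the upper bound of \<open>u\<close>, negative ones the upper
  bound \<open>Dpow q\<close> of \<open>inv u\<close>; the maximum covers both signs of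
  \<open>s\<close> in one formula.\<close>

lemma pow_le_Dpow:
  assumes u: "u \<in> carrier G" "Dpow (- q) \<preceq> u" "u \<preceq> Dpow p"
  shows "u [^] (s::int) \<preceq> Dpow (max (s * p) (- s * q))"
proof -
  have nat: "v \<up> n \<preceq> Dpow (int n * c)" if "v \<in> carrier G" "v \<preceq> Dpow c" for v c n
  proof (induction n)
    case (Suc n)
    then have "v \<up> n \<otimes> v \<preceq> Dpow (int n * c + c)" using that by (intro le_Dpow_mult) auto
    then show ?case by (simp add: algebra_simps)
  qed (simp add: P_one)
  show ?thesis
  proof (cases s rule: int_cases2)
    case (nonneg n)
    have "u \<up> n \<preceq> Dpow (int n * p)" using nat u by blast
    moreover have "Dpow (int n * p) \<preceq> Dpow (max (s * p) (- s * q))"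
      using nonneg by (intro Dpow_mono) simp
    ultimately show ?thesis
      using le_trans[of "u \<up> n" "Dpow (int n * p)"] nonneg u by (simp add: int_pow_int)
  next
    case (nonpos n)
    have "inv u \<preceq> Dpow q" using u inv_le_Dpow_iff by simp
    then have "inv u \<up> n \<preceq> Dpow (int n * q)" using nat u by simp
    moreover have "Dpow (int n * q) \<preceq> Dpow (max (s * p) (- s * q))"
      using nonpos by (intro Dpow_mono) simp
    moreover have "u [^] s = inv u \<up> n"
      using nonpos u by (simp add: int_pow_neg int_pow_int nat_pow_inv)
    ultimately show ?thesis
      using le_trans[of "inv u \<up> n" "Dpow (int n * q)"] u by simp
  qed
qed

section \<open>Conjugators balancing all powers at once\<close>

text \<open>The pairs \<open>(n, j)\<close> with \<open>n p \<le> j m\<close> and \<open>- n q \<le> j m\<close> form a subsemigroup of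
  \<open>\<int> \<times> \<int>\<close> acting on \<open>G\<close> by the order automorphisms \<open>z \<mapsto> g^n z \<Delta>^(-j)\<close>.
  Up to smaller elements the orbit of \<open>1\<close> is finite, since \<open>(m, p)\<close> and \<open>(- m, q)\<close> move \<open>1\<close>
  downwards; its join \<open>x\<close> is therefore moved downwards by the whole semigroup.\<close>

lemma balanced_conjugator:
  fixes m :: nat and p q :: int
  assumes g: "g \<in> carrier G" and m: "m > 0"
    and lower: "Dpow (- q) \<preceq> g \<up> m" and upper: "g \<up> m \<preceq> Dpow p"
    and "p \<ge> 0" "q \<ge> 0"
  obtains x where "x \<in> carrier G"
    "\<And>(n::int) j. n * p \<le> j * int m \<Longrightarrow> - n * q \<le> j * int m \<Longrightarrow> inv x \<otimes> g [^] n \<otimes> x \<preceq> Dpow j"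
proof -
  \<comment> \<open>\<open>N n \<le> j * int m\<close> encodes both conditions on
    \<open>(n, j)\<close>. Since \<open>p\<close> and \<open>q\<close> are nonnegative,
    \<open>N n\<close> is \<open>n * p\<close> for \<open>n \<ge> 0\<close> and
    \<open>- n * q\<close> for \<open>n \<le> 0\<close>; its subadditivity closes the set of pairs
    under addition.\<close>
  define N where "N n = max (n * p) (- n * q)" for n :: int
  define e where "e n j = g [^] n \<otimes> Dpow (- j)" for n j :: int
  \<comment> \<open>Representatives of the orbit: \<open>r\<close> is a remainder modulo
    \<open>m\<close>, and \<open>j\<close> can be capped at \<open>p + q\<close> because
    \<open>N r \<le> int m * (p + q)\<close> for such \<open>r\<close>, while larger
    \<open>j\<close> only give smaller elements.\<close>
  define J where "J = {(r, j). N r \<le> j * int m \<and> r \<in> {- int m<..<int m} \<and> j \<in> {0..p + q}}"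
  have ec [simp]: "e n j \<in> carrier G" for n j using g by (simp add: e_def)
  have N0: "N n \<ge> 0" for n
    using \<open>p \<ge> 0\<close> \<open>q \<ge> 0\<close> by (cases "n \<ge> 0") (auto simp: N_def le_max_iff_disj mult_nonpos_nonneg)
  have Nadd: "N (n + k) \<le> N n + N k" for n k
    by (simp add: N_def algebra_simps) linarith
  have N_bound: "N r \<le> int m * (p + q)" if "\<bar>r\<bar> < int m" for r
  proof -
    have "r * p \<le> int m * p" "- r * q \<le> int m * q"
      using that \<open>p \<ge> 0\<close> \<open>q \<ge> 0\<close> by (intro mult_right_mono; simp)+
    moreover have "0 \<le> int m * p" "0 \<le> int m * q"
      using \<open>p \<ge> 0\<close> \<open>q \<ge> 0\<close> by simp_all
    ultimately show ?thesis by (simp add: N_def algebra_simps)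
  qed
  have "finite J"
    by (rule finite_subset[of _ "{- int m<..<int m} \<times> {0..p + q}"]) (auto simp: J_def)
  moreover have "(0, 0) \<in> J"
    using m \<open>p \<ge> 0\<close> \<open>q \<ge> 0\<close> by (simp add: J_def N_def)
  moreover have "case_prod e ` J \<subseteq> carrier G" by auto
  ultimately obtain x where x: "is_join (case_prod e ` J) x"
    using join_finite[of "case_prod e ` J"] by blast
  then have xc: "x \<in> carrier G" by (simp add: is_join_def)
  have upper_all: "e n j \<preceq> x" if nj: "N n \<le> j * int m" for n j
  proof -
    \<comment> \<open>Division rounds towards zero, hence the double negation for negative
      \<open>n\<close>: then neither \<open>r\<close> nor \<open>s\<close> has the sign opposite to
      \<open>n\<close>, and \<open>N\<close> is linear on each half line.\<close>
    obtain r s where rs: "n = r + int m * s" "\<bar>r\<bar> < int m" "N n = N r + int m * N s"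
    proof (cases "n \<ge> 0")
      case True
      let ?r = "n mod int m" and ?s = "n div int m"
      have r: "0 \<le> ?r" "?r < int m" "0 \<le> ?s" using m True by (auto simp: pos_imp_zdiv_nonneg_iff)
      have pos: "N k = k * p" if "k \<ge> 0" for k
      proof -
        have "0 \<le> k * p" "- k * q \<le> 0"
          using that \<open>p \<ge> 0\<close> \<open>q \<ge> 0\<close> by (auto intro: mult_nonneg_nonneg)
        then show ?thesis by (simp add: N_def)
      qed
      have n: "n = ?r + int m * ?s" by simp
      have "N n = N ?r + int m * N ?s"
        unfolding pos[OF True] pos[OF r(1)] pos[OF r(3)] by (subst n) (simp only: algebra_simps)
      then show thesis using that[of ?r ?s] r by simp
    next
      case False
      let ?r = "- (- n mod int m)" and ?s = "- (- n div int m)"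
      have "0 \<le> - n mod int m" "- n mod int m < int m" "0 \<le> - n div int m"
        using m False by (auto simp: pos_imp_zdiv_nonneg_iff)
      then have r: "?r \<le> 0" "- int m < ?r" "?s \<le> 0" by auto
      have neg: "N k = - k * q" if "k \<le> 0" for k
      proof -
        have "k * p \<le> 0" "0 \<le> - k * q"
          using that \<open>p \<ge> 0\<close> \<open>q \<ge> 0\<close> by (auto intro: mult_nonpos_nonneg)
        then show ?thesis by (simp add: N_def)
      qed
      have "- n = - n mod int m + int m * (- n div int m)" by (rule mod_mult_div_eq[symmetric])
      then have n: "n = ?r + int m * ?s" unfolding mult_minus_right by linarith
      have split: "N n = N r + int m * N s" if "n = r + int m * s" "r \<le> 0" "s \<le> 0" for r s
        using that False by (simp only: neg) (simp add: neg algebra_simps)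
      have "N n = N ?r + int m * N ?s" by (rule split[OF n r(1) r(3)])
      then show thesis using that[of ?r ?s] n r by simp
    qed
    \<comment> \<open>Of the exponent \<open>j\<close>, the part \<open>N s\<close> absorbs the
      factor \<open>(g \<up> m) [^] s\<close>; the rest is capped at \<open>p + q\<close> to land in
      \<open>J\<close>, which can only enlarge \<open>e r i\<close>.\<close>
    define i where "i = min (j - N s) (p + q)"
    have i: "N r \<le> (j - N s) * int m" using nj rs by (simp add: algebra_simps)
    then have "0 \<le> (j - N s) * int m" using N0[of r] by linarith
    then have "0 \<le> j - N s" using m by (simp add: zero_le_mult_iff)
    then have "(r, i) \<in> J"
      using i N_bound[OF rs(2)] rs(2) \<open>p \<ge> 0\<close> \<open>q \<ge> 0\<close>
      by (auto simp: J_def i_def min_def algebra_simps)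
    then have ex: "e r i \<preceq> x" using x by (auto simp: is_join_def)
    have "(g \<up> m) [^] s \<otimes> Dpow (- j) \<preceq> Dpow (N s) \<otimes> Dpow (- j)"
      using pow_le_Dpow[OF _ lower upper] g by (intro le_mult_right) (auto simp: N_def)
    moreover have "Dpow (N s) \<otimes> Dpow (- j) = Dpow (- (j - N s))"
      by (simp flip: Dpow_add)
    moreover have "Dpow (- (j - N s)) \<preceq> Dpow (- i)"
      by (intro Dpow_mono) (simp add: i_def)
    ultimately have "(g \<up> m) [^] s \<otimes> Dpow (- j) \<preceq> Dpow (- i)"
      using le_trans[of "(g \<up> m) [^] s \<otimes> Dpow (- j)" "Dpow (- (j - N s))" "Dpow (- i)"] g by simp
    then have "g [^] r \<otimes> ((g \<up> m) [^] s \<otimes> Dpow (- j)) \<preceq> e r i"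
      unfolding e_def using g by (subst le_mult_left) auto
    moreover have "g [^] n = g [^] r \<otimes> (g \<up> m) [^] s"
      using g by (simp add: rs(1) int_pow_mult int_pow_pow flip: int_pow_int)
    ultimately have "e n j \<preceq> e r i"
      using g by (simp add: e_def m_assoc)
    then show ?thesis using le_trans[OF _ _ xc _ ex] by simp
  qed
  have "inv x \<otimes> g [^] n \<otimes> x \<preceq> Dpow j" if "n * p \<le> j * int m" "- n * q \<le> j * int m" for n j
  proof -
    \<comment> \<open>\<open>x \<preceq> ?w\<close> is equivalent to the goal, and as
      \<open>x\<close> is a join it can be tested on the elements \<open>e r i\<close>: the map of
      \<open>(n, j)\<close> sends \<open>e r i\<close> to \<open>e (n + r) (i + j)\<close>, which is
      below \<open>x\<close> by \<open>upper_all\<close>.\<close>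
    let ?w = "g [^] (- n) \<otimes> x \<otimes> Dpow j"
    have nj: "N n \<le> j * int m" using that by (simp add: N_def)
    have "e r i \<preceq> ?w" if "(r, i) \<in> J" for r i
    proof (rule le_mult_right_neg)
      have "N (n + r) \<le> (i + j) * int m"
        using Nadd[of n r] nj that by (simp add: J_def algebra_simps)
      then have "e (n + r) (i + j) \<preceq> x" by (rule upper_all)
      moreover have "e (n + r) (i + j) = g [^] n \<otimes> (e r i \<otimes> Dpow (- j))"
        using g by (simp add: e_def int_pow_mult m_assoc flip: Dpow_add)
      moreover have "x = g [^] n \<otimes> (g [^] (- n) \<otimes> x)"
        using g xc by (simp add: int_pow_neg)
      ultimately have "g [^] n \<otimes> (e r i \<otimes> Dpow (- j)) \<preceq> g [^] n \<otimes> (g [^] (- n) \<otimes> x)"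
        by simp
      then show "e r i \<otimes> Dpow (- j) \<preceq> g [^] (- n) \<otimes> x"
        using g xc by (subst (asm) le_mult_left) auto
    qed (use g xc in auto)
    then have "\<forall>s\<in>case_prod e ` J. s \<preceq> ?w" by auto
    moreover have "?w \<in> carrier G" using g xc by simp
    ultimately have "x \<preceq> ?w" using x unfolding is_join_def by blast
    then have "g [^] n \<otimes> x \<preceq> g [^] n \<otimes> ?w" using g xc by (subst le_mult_left) auto
    then have "g [^] n \<otimes> x \<preceq> x \<otimes> Dpow j"
      using g xc by (simp add: int_pow_neg m_assoc)
    then show ?thesis using g xc by (simp add: inv_mult_group m_assoc)
  qed
  from that[OF xc this] show thesis .
qed

text \<open>Optimal bounds for \<open>g \<up> m\<close> feed \<open>balanced_conjugator\<close>,
  whose \<open>x\<close> serves positive and negative exponents alike. Rounding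
  \<open>n p / m\<close> and \<open>n q / m\<close> up costs at most one letter each, whence the
  constant \<open>2\<close>, written as the instance \<open>C = 2\<close> of
  \<open>conjugate_near_linear\<close>.\<close>

lemma conjugate_powers_len:
  fixes m :: nat
  assumes g: "g \<in> carrier G" and m: "m > 0"
  shows "\<exists>x\<in>carrier G. \<forall>n::nat.
    real (len (inv x \<otimes> g \<up> n \<otimes> x)) \<le> n * real (len (g \<up> m)) / m + real 2"
proof -
  obtain p q where pq: "p + q = len (g \<up> m)" "Dpow (- int q) \<preceq> g \<up> m" "g \<up> m \<preceq> Dpow (int p)"
    using len_bounds[of "g \<up> m"] g by auto
  obtain x where x: "x \<in> carrier G"
    "\<And>(n::int) j. n * int p \<le> j * int m \<Longrightarrow> - n * int q \<le> j * int m \<Longrightarrow>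
      inv x \<otimes> g [^] n \<otimes> x \<preceq> Dpow j"
    using balanced_conjugator[OF g m pq(2,3)] by (metis of_nat_0_le_iff)
  have ceil: "\<exists>j. n * k \<le> j * m \<and> real j \<le> real n * k / m + 1" for n k :: nat
  proof -
    define j where "j = nat \<lceil>real n * k / m\<rceil>"
    have "real n * k / m \<le> real j" unfolding j_def by (rule real_nat_ceiling_ge)
    then have "real (n * k) \<le> real (j * m)" using m by (simp add: field_simps)
    then have "n * k \<le> j * m" by (simp only: of_nat_le_iff)
    moreover have "real n * k / m \<ge> 0" by simp
    then have "real j \<le> real n * k / m + 1" unfolding j_def by linarith
    ultimately show ?thesis by blast
  qed
  have "real (len (inv x \<otimes> g \<up> n \<otimes> x)) \<le> n * real (len (g \<up> m)) / m + real 2" for n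
  proof -
    let ?h = "inv x \<otimes> g \<up> n \<otimes> x"
    obtain i where i: "n * p \<le> i * m" "real i \<le> real n * p / m + 1" using ceil by blast
    obtain j where j: "n * q \<le> j * m" "real j \<le> real n * q / m + 1" using ceil by blast
    have hc: "?h \<in> carrier G" using g x by simp
    have "int n * int p \<le> int i * int m" "int n * int q \<le> int j * int m"
      using i(1) j(1) by (metis of_nat_le_iff of_nat_mult)+
    \<comment> \<open>For each sign of the exponent only one of the two conditions has content; the
      other has a nonpositive left side.\<close>
    moreover have "- int n * int q \<le> int i * int m" "- (- int n) * int q \<le> int j * int m"
      "- int n * int p \<le> int j * int m"
      using calculation by (auto intro: order_trans[of _ 0])
    ultimately have "inv x \<otimes> g [^] int n \<otimes> x \<preceq> Dpow (int i)"
      "inv x \<otimes> g [^] (- int n) \<otimes> x \<preceq> Dpow (int j)"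
      by (intro x(2); simp)+
    moreover have "inv x \<otimes> g [^] (- int n) \<otimes> x = inv ?h"
      using g x by (simp add: int_pow_neg int_pow_int inv_mult_group m_assoc)
    ultimately have "?h \<preceq> Dpow (int i)" "Dpow (- int j) \<preceq> ?h"
      using inv_le_Dpow_iff[OF hc, of "int j"] by (simp_all add: int_pow_int)
    then have "len ?h \<le> i + j" using len_le_of_bounds hc by blast
    then have "real (len ?h) \<le> (real n * p / m + 1) + (real n * q / m + 1)"
      using i(2) j(2) by linarith
    also have "\<dots> = n * real (len (g \<up> m)) / m + real 2"
      by (simp flip: pq(1) add: add_divide_distrib distrib_left)
    finally show ?thesis .
  qed
  with x(1) show ?thesis by blast
qed

section \<open>Infinite cyclic subgroups and the real line\<close>

lemma conjugate_powers_near_linear: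
  assumes "finite A" and g: "g \<in> carrier G" and inj: "inj (\<lambda>n::int. g \<Up> n)"
  obtains x and T :: real where "x \<in> carrier G" "T > 0"
    "\<And>n::int. \<bar>real (len (inv x \<otimes> g \<Up> n \<otimes> x)) - \<bar>n\<bar> * T\<bar> \<le> 2"
proof -
  obtain x and T :: real where x: "x \<in> carrier G" and "T \<ge> 0"
    and lower: "\<And>n::nat. n * T \<le> len (inv x \<otimes> g \<up> n \<otimes> x)"
    and upper: "\<And>n::nat. len (inv x \<otimes> g \<up> n \<otimes> x) \<le> n * T + real 2"
    using conjugate_near_linear[OF \<open>finite A\<close> g conjugate_powers_len[OF g]] by blast
  have "len (inv x \<otimes> g \<Up> n \<otimes> x) = len (inv x \<otimes> g \<up> nat \<bar>n\<bar> \<otimes> x)" for n :: int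
    unfolding conj_int_pow[OF x g] conj_nat_pow[OF x g] using x g by (intro len_int_pow) simp
  then have near: "\<bar>real (len (inv x \<otimes> g \<Up> n \<otimes> x)) - \<bar>n\<bar> * T\<bar> \<le> 2" for n :: int
    using lower[of "nat \<bar>n\<bar>"] upper[of "nat \<bar>n\<bar>"] by simp
  \<comment> \<open>With \<open>T = 0\<close> all conjugated powers would lie in the finite ball of
    radius \<open>2\<close>, although they are pairwise distinct.\<close>
  have "T \<noteq> 0"
  proof
    assume "T = 0"
    then have "range (\<lambda>n::int. inv x \<otimes> g \<Up> n \<otimes> x) \<subseteq> {y \<in> carrier G. len y \<le> 2}"
      using near x g by auto
    then have "finite (range (\<lambda>n::int. inv x \<otimes> g \<Up> n \<otimes> x))"
      by (rule finite_subset[OF _ finite_len_ball[OF \<open>finite A\<close>]])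
    moreover have "inj (\<lambda>n::int. inv x \<otimes> g \<Up> n \<otimes> x)"
      using inj x g by (auto simp: inj_def)
    ultimately have "finite (UNIV :: int set)" by (rule finite_imageD)
    then show False using infinite_UNIV_int by blast
  qed
  then have "T > 0" using \<open>T \<ge> 0\<close> by simp
  from that[OF x this near] show thesis .
qed

lemma quasi_isometric_powers:
  fixes T :: real
  assumes g: "g \<in> carrier G" and inj: "inj (\<lambda>n::int. g \<Up> n)" and "T > 0" "\<epsilon> \<ge> 0"
    and near: "\<And>n::int. \<bar>real (len (g \<Up> n)) - \<bar>n\<bar> * T\<bar> \<le> \<epsilon>"
  shows "quasi_isometric 1 \<epsilon> (range (\<lambda>n::int. g \<Up> n)) (word_dist G A) (UNIV :: real set) dist"
proof -
  define k where "k = the_inv (\<lambda>n::int. g \<Up> n)"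
  have k: "k (g \<Up> n) = n" for n :: int
    unfolding k_def using the_inv_f_f[OF inj] by simp
  \<comment> \<open>\<open>g \<Up> n\<close> goes to \<open>n * T\<close>. By left invariance only
    the difference of exponents matters, and with scale \<open>T\<close> the distances agree up to
    \<epsilon>, so the factor is \<open>1\<close>.\<close>
  define f where "f y = of_int (k y) * T" for y
  have d: "word_dist G A (g \<Up> m) (g \<Up> n) = len (g \<Up> (n - m))" for m n :: int
  proof -
    have "inv (g \<Up> m) \<otimes> g \<Up> n = g \<Up> (- m + n)"
      by (simp only: int_pow_neg[OF g] int_pow_mult[OF g])
    then show ?thesis by (simp add: word_dist_def)
  qed
  have "dist (of_int m * T) (of_int n * T) = \<bar>n - m\<bar> * T" for m n :: int
    using \<open>T > 0\<close> by (simp add: dist_real_def abs_mult abs_minus_commute flip: left_diff_distrib)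
  then have "dist (f (g \<Up> m)) (f (g \<Up> n)) = \<bar>n - m\<bar> * T" for m n :: int
    by (simp only: f_def k)
  then have "\<bar>word_dist G A (g \<Up> m) (g \<Up> n) - dist (f (g \<Up> m)) (f (g \<Up> n))\<bar> \<le> \<epsilon>" for m n :: int
    using near[of "n - m"] by (simp only: d)
  then have "qi_embedding 1 \<epsilon> (range (\<lambda>n::int. g \<Up> n)) (word_dist G A) UNIV dist f"
    using \<open>\<epsilon> \<ge> 0\<close> unfolding qi_embedding_def by (fastforce simp: abs_le_iff algebra_simps)
  moreover have "coarsely_surjective (range (\<lambda>n::int. g \<Up> n)) UNIV dist f"
    unfolding coarsely_surjective_def
  proof (intro exI[of _ T] conjI ballI)
    fix y :: real
    have "\<lfloor>y / T\<rfloor> * T \<le> y" "y \<le> \<lfloor>y / T\<rfloor> * T + T"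
      using floor_divide_lower[OF \<open>T > 0\<close>, of y] floor_divide_upper[OF \<open>T > 0\<close>, of y]
      by (simp_all add: distrib_right)
    then have "dist y (f (g \<Up> \<lfloor>y / T\<rfloor>)) \<le> T"
      by (simp add: f_def k dist_real_def)
    then show "\<exists>x\<in>range (\<lambda>n::int. g \<Up> n). dist y (f x) \<le> T" by blast
  qed (use \<open>T > 0\<close> in simp)
  ultimately show ?thesis unfolding quasi_isometric_def by blast
qed

theorem infinite_cyclic_quasi_isometric_line:
  assumes "finite A" and H: "subgroup H G" "cyclic_group (G\<lparr>carrier := H\<rparr>)" "infinite H"
  shows "\<exists>g\<in>carrier G.
      quasi_isometric 1 2 (inv g <# H #> g) (word_dist G A) (UNIV :: real set) dist"
    and "\<exists>\<epsilon>\<ge>0. quasi_isometric 1 \<epsilon> H (word_dist G A) (UNIV :: real set) dist"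
proof -
  interpret H: group "G\<lparr>carrier := H\<rparr>"
    using H(1) subgroup.subgroup_is_group is_group by blast
  obtain c where c: "c \<in> H" "H = range (\<lambda>n::int. c [^]\<^bsub>G\<lparr>carrier := H\<rparr>\<^esub> n)"
    using H(2) H.cyclic_group by auto
  have cG: "c \<in> carrier G" using c(1) H(1) subgroup.mem_carrier by metis
  have Hc: "H = range (\<lambda>n. c \<Up> n)"
    using c(2) int_pow_consistent[OF H(1) c(1)] by simp
  have inj: "inj (\<lambda>n. c \<Up> n)"
    using infinite_cyclic_subgroup_int[OF cG] carrier_subgroup_generated_by_singleton[OF cG]
      \<open>infinite H\<close> Hc by (auto simp: inj_def)
  obtain x and T :: real where x: "x \<in> carrier G" and T: "T > 0"
    and near: "\<And>n::int. \<bar>real (len (inv x \<otimes> c \<Up> n \<otimes> x)) - \<bar>n\<bar> * T\<bar> \<le> 2"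
    using conjugate_powers_near_linear[OF \<open>finite A\<close> cG inj] by blast
  define h where "h = inv x \<otimes> c \<otimes> x"
  have h: "h \<in> carrier G" using x cG by (simp add: h_def)
  have conj: "inv x \<otimes> c \<Up> n \<otimes> x = h \<Up> n" for n :: int
    unfolding h_def by (rule conj_int_pow[OF x cG])
  have "inj (\<lambda>n. inv x \<otimes> c \<Up> n \<otimes> x)"
    using inj x cG by (auto simp: inj_def)
  then have "quasi_isometric 1 2 (range (\<lambda>n. h \<Up> n)) (word_dist G A) (UNIV :: real set) dist"
    using near T h unfolding conj by (intro quasi_isometric_powers[of _ T]) auto
  moreover have "inv x <# H #> x = range (\<lambda>n. inv x \<otimes> c \<Up> n \<otimes> x)"
    unfolding Hc by (auto simp: l_coset_def r_coset_def)
  ultimately show "\<exists>g\<in>carrier G.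
      quasi_isometric 1 2 (inv g <# H #> g) (word_dist G A) (UNIV :: real set) dist"
    unfolding conj using x by metis
  \<comment> \<open>Undoing the conjugation changes each length by at most \<open>2 * len x\<close>,
    so \<open>H\<close> keeps the slope \<open>T\<close> with a larger additive constant.\<close>
  have "\<bar>real (len (c \<Up> n)) - \<bar>n\<bar> * T\<bar> \<le> 2 + 2 * real (len x)" for n :: int
    using near[of n] len_conj[OF x, of "c \<Up> n"] len_conj'[OF x, of "c \<Up> n"] cG
    by (simp add: abs_le_iff)
  then have "quasi_isometric 1 (2 + 2 * real (len x)) H (word_dist G A) (UNIV :: real set) dist"
    unfolding Hc using T cG inj by (intro quasi_isometric_powers[of _ T]) auto
  then show "\<exists>\<epsilon>\<ge>0. quasi_isometric 1 \<epsilon> H (word_dist G A) (UNIV :: real set) dist"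
    by (intro exI[of _ "2 + 2 * real (len x)"]) simp
qed

end

section \<open>Groups of fractions of Garside monoids\<close>

text \<open>When an atom is spelled as a word, the head or the value of the tail is
  \<open>\<one>\<close>, so by induction the atom is one of the letters. Finite generation therefore
  leaves only finitely many atoms.\<close>

lemma atoms_subset_generators:
  assumes "monoid M" and S: "monoid_generates M S"
  shows "atoms M \<subseteq> S"
proof
  interpret monoid M by fact
  have SM: "S \<subseteq> carrier M" using S unfolding monoid_generates_def by blast
  have "word_value M ws \<in> atoms M \<Longrightarrow> word_value M ws \<in> S" if "ws \<in> lists S" for ws
    using that
  proof (induction ws)
    case Nil
    then show ?case by (simp add: atoms_def)
  next
    case (Cons w ws)
    then have c: "w \<in> carrier M" "word_value M ws \<in> carrier M" "w \<in> S"
      using SM by (auto intro!: word_value_closed)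
    with Cons.prems have "w = \<one>\<^bsub>M\<^esub> \<or> word_value M ws = \<one>\<^bsub>M\<^esub>"
      by (auto simp: atoms_def)
    then show ?case using Cons c by auto
  qed
  moreover fix a assume a: "a \<in> atoms M"
  moreover obtain ws where "ws \<in> lists S" "word_value M ws = a"
    using a S by (auto simp: monoid_generates_def atoms_def)
  ultimately show "a \<in> S" by blast
qed

text \<open>An atom word of a left divisor of \<Delta> extends to one of \<Delta>, so its length is
  at most \<open>max_atom_length M \<Delta>\<close>; over finitely many atoms only finitely many
  such words exist.\<close>

lemma finite_simple_elements:
  assumes atomic: "atomic_monoid M" and "finite S" "monoid_generates M S"
    and \<Delta>: "\<Delta> \<in> carrier M"
  shows "finite (simple_elements M \<Delta>)"
proof -
  interpret monoid M using atomic by (simp add: atomic_monoid_def)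
  have gen: "monoid_generates M (atoms M)" using atomic by (simp add: atomic_monoid_def)
  have fin: "finite (atoms M)"
    using atoms_subset_generators[OF monoid_axioms] assms finite_subset by blast
  have "max_atom_length M \<Delta> < \<infinity>" using atomic \<Delta> by (simp add: atomic_monoid_def)
  then obtain N where N: "max_atom_length M \<Delta> = enat N" by auto
  have "simple_elements M \<Delta> \<subseteq> word_value M ` {ws. set ws \<subseteq> atoms M \<and> length ws \<le> N}"
  proof
    fix a assume "a \<in> simple_elements M \<Delta>"
    then obtain c where c: "a \<in> carrier M" "c \<in> carrier M" "a \<otimes>\<^bsub>M\<^esub> c = \<Delta>"
      by (auto simp: simple_elements_def left_le_def)
    obtain us where us: "us \<in> lists (atoms M)" "word_value M us = a"
      using c gen by (auto simp: monoid_generates_def)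
    obtain vs where vs: "vs \<in> lists (atoms M)" "word_value M vs = c"
      using c gen by (auto simp: monoid_generates_def)
    have "lists (atoms M) \<subseteq> lists (carrier M)"
      using gen unfolding monoid_generates_def by blast
    then have "word_value M (us @ vs) = \<Delta>" using us vs c word_value_append by blast
    then have "enat (length (us @ vs)) \<le> max_atom_length M \<Delta>"
      unfolding max_atom_length_def using us vs by (intro SUP_upper) auto
    then show "a \<in> word_value M ` {ws. set ws \<subseteq> atoms M \<and> length ws \<le> N}"
      using us N by (auto simp: image_iff in_lists_conv_set)
  qed
  then show ?thesis
    using finite_subset finite_lists_length_le[OF fin] by blast
qed

text \<open>The simple elements are closed under complements, so each of them can be moved across \<open>\<Delta>\<close>.\<close>

lemma garside_element_quasi_central:
  assumes "monoid M" and \<Delta>: "garside_element M \<Delta>" and a: "a \<in> carrier M"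
  shows "\<exists>b\<in>carrier M. a \<otimes>\<^bsub>M\<^esub> \<Delta> = \<Delta> \<otimes>\<^bsub>M\<^esub> b" "\<exists>b\<in>carrier M. \<Delta> \<otimes>\<^bsub>M\<^esub> a = b \<otimes>\<^bsub>M\<^esub> \<Delta>"
proof -
  interpret monoid M by fact
  let ?D = "simple_elements M \<Delta>"
  have \<Delta>c: "\<Delta> \<in> carrier M" and lr: "\<And>a. a \<in> carrier M \<Longrightarrow> left_le M a \<Delta> \<longleftrightarrow> right_le M a \<Delta>"
    and gen: "monoid_generates M ?D"
    using \<Delta> by (auto simp: garside_element_def)
  \<comment> \<open>With \<open>d e = \<Delta>\<close>, the right divisor \<open>e\<close> is also a
    left divisor, say \<open>e f = \<Delta>\<close>; so
    \<open>d \<Delta> = d e f = \<Delta> f\<close>.\<close>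
  have simple1: "\<exists>b\<in>carrier M. d \<otimes>\<^bsub>M\<^esub> \<Delta> = \<Delta> \<otimes>\<^bsub>M\<^esub> b" if d: "d \<in> ?D" for d
  proof -
    obtain e where e: "e \<in> carrier M" "d \<otimes>\<^bsub>M\<^esub> e = \<Delta>"
      using d by (auto simp: simple_elements_def left_le_def)
    then have "right_le M e \<Delta>" using d by (auto simp: right_le_def simple_elements_def)
    then obtain f where "f \<in> carrier M" "e \<otimes>\<^bsub>M\<^esub> f = \<Delta>"
      using lr e by (auto simp: left_le_def)
    then show ?thesis
      using d e by (metis (no_types, lifting) m_assoc mem_Collect_eq simple_elements_def)
  qed
  \<comment> \<open>Mirror image: \<open>e d = \<Delta>\<close> and \<open>f e = \<Delta>\<close>
    give \<open>\<Delta> d = f e d = f \<Delta>\<close>.\<close>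
  have simple2: "\<exists>b\<in>carrier M. \<Delta> \<otimes>\<^bsub>M\<^esub> d = b \<otimes>\<^bsub>M\<^esub> \<Delta>" if d: "d \<in> ?D" for d
  proof -
    have "right_le M d \<Delta>" using d lr unfolding simple_elements_def by blast
    then obtain e where e: "e \<in> carrier M" "e \<otimes>\<^bsub>M\<^esub> d = \<Delta>"
      by (auto simp: right_le_def)
    then have "left_le M e \<Delta>" using d by (auto simp: left_le_def simple_elements_def)
    then obtain f where "f \<in> carrier M" "f \<otimes>\<^bsub>M\<^esub> e = \<Delta>"
      using lr e by (auto simp: right_le_def)
    then show ?thesis
      using d e by (metis (no_types, lifting) m_assoc mem_Collect_eq simple_elements_def)
  qed
  have D: "?D \<subseteq> carrier M" by (auto simp: simple_elements_def)
  have "(\<exists>b\<in>carrier M. word_value M ws \<otimes>\<^bsub>M\<^esub> \<Delta> = \<Delta> \<otimes>\<^bsub>M\<^esub> b) \<and>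
      (\<exists>b\<in>carrier M. \<Delta> \<otimes>\<^bsub>M\<^esub> word_value M ws = b \<otimes>\<^bsub>M\<^esub> \<Delta>)" if "ws \<in> lists ?D" for ws
    using that
  proof (induction ws)
    case Nil
    then show ?case using \<Delta>c by (auto intro!: bexI[of _ "\<one>\<^bsub>M\<^esub>"])
  next
    case (Cons w ws)
    then have w: "w \<in> ?D" "w \<in> carrier M" "word_value M ws \<in> carrier M"
      using D by (auto intro!: word_value_closed)
    obtain b b' where b: "b \<in> carrier M" "word_value M ws \<otimes>\<^bsub>M\<^esub> \<Delta> = \<Delta> \<otimes>\<^bsub>M\<^esub> b"
      "b' \<in> carrier M" "\<Delta> \<otimes>\<^bsub>M\<^esub> word_value M ws = b' \<otimes>\<^bsub>M\<^esub> \<Delta>"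
      using Cons by auto
    obtain c where c: "c \<in> carrier M" "w \<otimes>\<^bsub>M\<^esub> \<Delta> = \<Delta> \<otimes>\<^bsub>M\<^esub> c" using simple1 w by blast
    obtain c' where c': "c' \<in> carrier M" "\<Delta> \<otimes>\<^bsub>M\<^esub> w = c' \<otimes>\<^bsub>M\<^esub> \<Delta>" using simple2 w by blast
    have "word_value M (w # ws) \<otimes>\<^bsub>M\<^esub> \<Delta> = \<Delta> \<otimes>\<^bsub>M\<^esub> (c \<otimes>\<^bsub>M\<^esub> b)"
      using w b c \<Delta>c by (metis m_assoc word_value_Cons)
    moreover have "\<Delta> \<otimes>\<^bsub>M\<^esub> word_value M (w # ws) = (c' \<otimes>\<^bsub>M\<^esub> b') \<otimes>\<^bsub>M\<^esub> \<Delta>"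
      using w b c' \<Delta>c by (metis m_assoc word_value_Cons)
    ultimately show ?case using b c c' by blast
  qed
  moreover obtain ws where "ws \<in> lists ?D" "word_value M ws = a"
    using a gen by (auto simp: monoid_generates_def)
  ultimately show "\<exists>b\<in>carrier M. a \<otimes>\<^bsub>M\<^esub> \<Delta> = \<Delta> \<otimes>\<^bsub>M\<^esub> b" "\<exists>b\<in>carrier M. \<Delta> \<otimes>\<^bsub>M\<^esub> a = b \<otimes>\<^bsub>M\<^esub> \<Delta>"
    by blast+
qed

text \<open>By injectivity of \<open>\<iota>\<close>, the group order restricted to the image of
  \<open>M\<close> is left divisibility (\<open>le_iff\<close>); this turns the order assumptions of
  the locale into statements about \<open>M\<close>.\<close>

lemma garside_group_fractions:
  fixes M :: "('m, 'b) monoid_scheme" and G :: "('g, 'c) monoid_scheme"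
  assumes M: "garside_monoid M" and \<Delta>: "garside_element M \<Delta>"
    and G: "group_of_fractions M G \<iota>"
  shows "garside_group G (\<iota> ` simple_elements M \<Delta>) (\<iota> ` carrier M) (\<iota> \<Delta>)"
proof -
  interpret M: monoid M using M by (simp add: garside_monoid_def atomic_monoid_def)
  interpret G: group G using G by (simp add: group_of_fractions_def)
  interpret L: lattice "left_order M" using M by (simp add: garside_monoid_def)
  let ?D = "simple_elements M \<Delta>" and ?P = "\<iota> ` carrier M"
  have hom: "\<And>a. a \<in> carrier M \<Longrightarrow> \<iota> a \<in> carrier G"
    "\<And>a b. a \<in> carrier M \<Longrightarrow> b \<in> carrier M \<Longrightarrow> \<iota> (a \<otimes>\<^bsub>M\<^esub> b) = \<iota> a \<otimes>\<^bsub>G\<^esub> \<iota> b"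
    and inj: "inj_on \<iota> (carrier M)"
    and frac: "\<And>g. g \<in> carrier G \<Longrightarrow>
      \<exists>a\<in>carrier M. \<exists>b\<in>carrier M. g = \<iota> a \<otimes>\<^bsub>G\<^esub> inv\<^bsub>G\<^esub> (\<iota> b)"
    using G by (auto simp: group_of_fractions_def hom_def)
  have one: "\<iota> \<one>\<^bsub>M\<^esub> = \<one>\<^bsub>G\<^esub>"
    using hom(2)[of "\<one>\<^bsub>M\<^esub>" "\<one>\<^bsub>M\<^esub>"] hom(1)[of "\<one>\<^bsub>M\<^esub>"] by simp
  have \<Delta>c: "\<Delta> \<in> carrier M" and gen: "monoid_generates M ?D"
    using \<Delta> by (auto simp: garside_element_def)
  have DM: "?D \<subseteq> carrier M" by (auto simp: simple_elements_def)
  have le_iff: "inv\<^bsub>G\<^esub> (\<iota> a) \<otimes>\<^bsub>G\<^esub> \<iota> b \<in> ?P \<longleftrightarrow> left_le M a b" if "a \<in> carrier M" "b \<in> carrier M" for a b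
  proof
    assume "inv\<^bsub>G\<^esub> (\<iota> a) \<otimes>\<^bsub>G\<^esub> \<iota> b \<in> ?P"
    then obtain c where c: "c \<in> carrier M" "inv\<^bsub>G\<^esub> (\<iota> a) \<otimes>\<^bsub>G\<^esub> \<iota> b = \<iota> c" by auto
    then have "\<iota> b = \<iota> (a \<otimes>\<^bsub>M\<^esub> c)"
      using that hom by (metis G.inv_mult_cancel(2))
    then have "a \<otimes>\<^bsub>M\<^esub> c = b" using inj that c by (auto simp: inj_on_def)
    then show "left_le M a b" using c by (auto simp: left_le_def)
  next
    assume "left_le M a b"
    then show "inv\<^bsub>G\<^esub> (\<iota> a) \<otimes>\<^bsub>G\<^esub> \<iota> b \<in> ?P" using that hom by (auto simp: left_le_def)
  qed
  have words: "\<exists>ws\<in>lists (\<iota> ` ?D). word_value G ws = \<iota> a" if a: "a \<in> carrier M" for a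
  proof -
    have "word_value G (map \<iota> ws) = \<iota> (word_value M ws)" if "ws \<in> lists ?D" for ws
      using that
    proof (induction ws)
      case (Cons w ws)
      then have "w \<in> carrier M" "word_value M ws \<in> carrier M"
        using DM by (auto intro!: M.word_value_closed)
      with Cons show ?case by (auto simp: hom)
    qed (simp add: one)
    moreover obtain ws where ws: "ws \<in> lists ?D" "word_value M ws = a"
      using a gen by (auto simp: monoid_generates_def)
    moreover have "map \<iota> ws \<in> lists (\<iota> ` ?D)" using ws by (auto simp: in_lists_conv_set)
    ultimately show ?thesis by metis
  qed
  have DG: "\<iota> ` ?D \<subseteq> carrier G" using DM hom by auto
  show ?thesis
  proof
    show "\<iota> ` ?D \<subseteq> carrier G" by (rule DG)
    show "\<exists>ws\<in>lists (\<iota> ` ?D \<union> (\<lambda>a. inv\<^bsub>G\<^esub> a) ` \<iota> ` ?D). word_value G ws = g"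
      if g: "g \<in> carrier G" for g
    proof -
      obtain a b where ab: "a \<in> carrier M" "b \<in> carrier M" "g = \<iota> a \<otimes>\<^bsub>G\<^esub> inv\<^bsub>G\<^esub> (\<iota> b)"
        using frac[OF g] by blast
      obtain us where us: "us \<in> lists (\<iota> ` ?D)" "word_value G us = \<iota> a" using words ab by blast
      obtain vs where vs: "vs \<in> lists (\<iota> ` ?D)" "word_value G vs = \<iota> b" using words ab by blast
      let ?ws = "us @ rev (map (\<lambda>x. inv\<^bsub>G\<^esub> x) vs)"
      have c: "us \<in> lists (carrier G)" "vs \<in> lists (carrier G)"
        using us(1) vs(1) DG lists_mono by blast+
      then have "rev (map (\<lambda>x. inv\<^bsub>G\<^esub> x) vs) \<in> lists (carrier G)"
        by (auto simp: in_lists_conv_set)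
      then have "word_value G ?ws = g"
        using c us vs ab by (simp add: G.word_value_append flip: G.word_value_inv)
      moreover have "?ws \<in> lists (\<iota> ` ?D \<union> (\<lambda>a. inv\<^bsub>G\<^esub> a) ` \<iota> ` ?D)"
        using us vs by (auto simp: in_lists_conv_set)
      ultimately show ?thesis by blast
    qed
    show "x \<in> carrier G" if "x \<in> ?P" for x using that hom by auto
    show "\<one>\<^bsub>G\<^esub> \<in> ?P" using one by (metis M.one_closed image_eqI)
    show "x \<otimes>\<^bsub>G\<^esub> y \<in> ?P" if "x \<in> ?P" "y \<in> ?P" for x y
      using that hom(2) by (auto simp flip: hom(2))
    show "x = \<one>\<^bsub>G\<^esub>" if x: "x \<in> ?P" "inv\<^bsub>G\<^esub> x \<in> ?P" for x
    proof -
      obtain a where a: "a \<in> carrier M" "x = \<iota> a" using x by auto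
      have "left_le M a \<one>\<^bsub>M\<^esub>"
        using le_iff[of a "\<one>\<^bsub>M\<^esub>"] a x hom by (simp add: one)
      moreover have "left_le M \<one>\<^bsub>M\<^esub> a" using a by (auto simp: left_le_def)
      ultimately have "a = \<one>\<^bsub>M\<^esub>"
        using L.le_antisym[of a "\<one>\<^bsub>M\<^esub>"] a by (simp add: left_order_def)
      then show ?thesis using a one by simp
    qed
    show "\<iota> \<Delta> \<in> ?P" using \<Delta>c by blast
    show "inv\<^bsub>G\<^esub> (\<iota> \<Delta>) \<otimes>\<^bsub>G\<^esub> x \<otimes>\<^bsub>G\<^esub> \<iota> \<Delta> \<in> ?P" if x: "x \<in> ?P" for x
    proof -
      obtain a where a: "a \<in> carrier M" "x = \<iota> a" using x by auto
      obtain b where b: "b \<in> carrier M" "a \<otimes>\<^bsub>M\<^esub> \<Delta> = \<Delta> \<otimes>\<^bsub>M\<^esub> b"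
        using garside_element_quasi_central(1)[OF M.monoid_axioms \<Delta> a(1)] by blast
      then have "\<iota> a \<otimes>\<^bsub>G\<^esub> \<iota> \<Delta> = \<iota> \<Delta> \<otimes>\<^bsub>G\<^esub> \<iota> b" using a \<Delta>c by (metis hom(2))
      then show ?thesis using a b \<Delta>c hom(1) by (simp add: G.m_assoc)
    qed
    show "\<iota> \<Delta> \<otimes>\<^bsub>G\<^esub> x \<otimes>\<^bsub>G\<^esub> inv\<^bsub>G\<^esub> (\<iota> \<Delta>) \<in> ?P" if x: "x \<in> ?P" for x
    proof -
      obtain a where a: "a \<in> carrier M" "x = \<iota> a" using x by auto
      obtain b where b: "b \<in> carrier M" "\<Delta> \<otimes>\<^bsub>M\<^esub> a = b \<otimes>\<^bsub>M\<^esub> \<Delta>"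
        using garside_element_quasi_central(2)[OF M.monoid_axioms \<Delta> a(1)] by blast
      then have "\<iota> \<Delta> \<otimes>\<^bsub>G\<^esub> \<iota> a = \<iota> b \<otimes>\<^bsub>G\<^esub> \<iota> \<Delta>" using a \<Delta>c by (metis hom(2))
      then show ?thesis using a b \<Delta>c hom(1) by (simp add: G.m_assoc)
    qed
    show "\<iota> ` ?D = {a \<in> ?P. inv\<^bsub>G\<^esub> a \<otimes>\<^bsub>G\<^esub> \<iota> \<Delta> \<in> ?P}"
      using le_iff \<Delta>c by (auto simp: simple_elements_def)
    show "\<exists>z\<in>?P. inv\<^bsub>G\<^esub> x \<otimes>\<^bsub>G\<^esub> z \<in> ?P \<and> inv\<^bsub>G\<^esub> y \<otimes>\<^bsub>G\<^esub> z \<in> ?P \<and>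
        (\<forall>w\<in>?P. inv\<^bsub>G\<^esub> x \<otimes>\<^bsub>G\<^esub> w \<in> ?P \<longrightarrow> inv\<^bsub>G\<^esub> y \<otimes>\<^bsub>G\<^esub> w \<in> ?P \<longrightarrow> inv\<^bsub>G\<^esub> z \<otimes>\<^bsub>G\<^esub> w \<in> ?P)"
      if xy: "x \<in> ?P" "y \<in> ?P" for x y
    proof -
      obtain a b where ab: "a \<in> carrier M" "x = \<iota> a" "b \<in> carrier M" "y = \<iota> b"
        using xy by auto
      obtain s where "least (left_order M) s (Upper (left_order M) {a, b})"
        using L.sup_of_two_exists[of a b] ab by (auto simp: left_order_def)
      then have s: "s \<in> carrier M" "left_le M a s" "left_le M b s"
        "\<And>w. w \<in> carrier M \<Longrightarrow> left_le M a w \<Longrightarrow> left_le M b w \<Longrightarrow> left_le M s w"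
        using ab by (auto simp: least_def Upper_def left_order_def)
      show ?thesis
        using s ab by (intro bexI[of _ "\<iota> s"]) (auto simp: le_iff)
    qed
  qed
qed

theorem proposition6p4:
  fixes M :: "('m, 'b) monoid_scheme" and G :: "('g, 'c) monoid_scheme"
    and \<iota> :: "'m \<Rightarrow> 'g" and \<Delta> :: 'm and H :: "'g set"
  assumes "garside_monoid M" and "garside_element M \<Delta>"
    and "group_of_fractions M G \<iota>"
    and "subgroup H G" and "cyclic_group (G\<lparr>carrier := H\<rparr>)" and "infinite H"
  shows "(\<exists>g\<in>carrier G.
            quasi_isometric 1 2 ((inv\<^bsub>G\<^esub> g) <#\<^bsub>G\<^esub> H #>\<^bsub>G\<^esub> g)
              (garside_dist M \<Delta> G \<iota>) (UNIV :: real set) dist) \<and>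
         (\<exists>\<epsilon>\<ge>0. quasi_isometric 1 \<epsilon> H
              (garside_dist M \<Delta> G \<iota>) (UNIV :: real set) dist)"
proof -
  define A where "A = \<iota> ` simple_elements M \<Delta>"
  interpret garside_group G A "\<iota> ` carrier M" "\<iota> \<Delta>"
    unfolding A_def using assms by (intro garside_group_fractions)
  obtain S where "atomic_monoid M" "finite S" "monoid_generates M S"
    using assms(1) by (auto simp: garside_monoid_def)
  moreover have "\<Delta> \<in> carrier M" using assms(2) by (simp add: garside_element_def)
  ultimately have "finite (simple_elements M \<Delta>)" by (rule finite_simple_elements)
  then have "finite A" by (simp add: A_def)
  have dist: "garside_dist M \<Delta> G \<iota> = word_dist G A"
    by (simp add: garside_dist_def A_def)
  show ?thesis
    unfolding dist using infinite_cyclic_quasi_isometric_line[OF \<open>finite A\<close> assms(4-6)] by blast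
qed

end
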